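(* Let $f,g:[a,b]\to\mathbb{R}$ be differentiable functions and $0<\alpha\le1$. Then $$\int_a^b (T_\alpha^a f)(t)\,g(t)\,d_\alpha(t,a)=\int_a^b f(t)\,({}^{b}T_\alpha g)(t)\,d_\alpha(b,t)+f(t)g(t)\Big|_a^b.$$
   Context: For $0<\alpha\le1$, the left conformable fractional derivative starting from $a$ and the right conformable fractional derivative terminating at $b$ are $$(T_\alpha^a f)(t)=\lim_{\epsilon\to0}\frac{f(t+\epsilon (t-a)^{1-\alpha})-f(t)}{\epsilon},\qquad ({}^{b}T_\alpha g)(t)=-\lim_{\epsilon\to0}\frac{g(t+\epsilon (b-t)^{1-\alpha})-g(t)}{\epsilon}.$$ The notations $d_\alpha(t,a)$ and $d_\alpha(b,t)$ mean $(t-a)^{\alpha-1}dt$ and $(b-t)^{\alpha-1}dt$, respectively, and $F(t)|_a^b=F(b)-F(a)$.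
   Formalization: Since differentiability of f and g alone does not ensure that the integrals exist, at least one of the two integrals is assumed to exist (in the Henstock–Kurzweil sense); the existence of the other and the equality are then proved. *)

theory Defs
  imports "HOL-Analysis.Analysis"
begin

text \<open>
  Real powers with \<open>x\<^sup>0 = 1\<close> also at \<open>x = 0\<close>. Since \<open>0 powr 0 = 0\<close> in the library, plain
  \<open>powr\<close> would give the wrong value at the endpoint in the classical case \<open>\<alpha> = 1\<close>, where
  the conformable operators reduce to the ordinary derivative and integral.
\<close>
definition rpow :: "real \<Rightarrow> real \<Rightarrow> real" where
  "rpow x p = (if p = 0 then 1 else x powr p)"

text \<open>
  In the two derivatives, \<open>D\<close> is the domain of the function: the increment \<open>\<epsilon>\<close> ranges only
  over those values for which the difference quotient is defined. In the interior of \<open>D\<close> this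
  is the unrestricted limit, at an endpoint it may become one-sided.
\<close>
definition left_conf_deriv :: "real \<Rightarrow> real \<Rightarrow> real set \<Rightarrow> (real \<Rightarrow> real) \<Rightarrow> real \<Rightarrow> real" where
  "left_conf_deriv \<alpha> a D f t =
     Lim (at 0 within {\<epsilon>. t + \<epsilon> * rpow (t - a) (1 - \<alpha>) \<in> D})
       (\<lambda>\<epsilon>. (f (t + \<epsilon> * rpow (t - a) (1 - \<alpha>)) - f t) / \<epsilon>)"

definition right_conf_deriv :: "real \<Rightarrow> real \<Rightarrow> real set \<Rightarrow> (real \<Rightarrow> real) \<Rightarrow> real \<Rightarrow> real" where
  "right_conf_deriv \<alpha> b D g t =
     - Lim (at 0 within {\<epsilon>. t + \<epsilon> * rpow (b - t) (1 - \<alpha>) \<in> D})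
         (\<lambda>\<epsilon>. (g (t + \<epsilon> * rpow (b - t) (1 - \<alpha>)) - g t) / \<epsilon>)"

text \<open>
  Integrals over \<open>[a,b]\<close> against \<open>d\<^sub>\<alpha>(t,a)\<close> and \<open>d\<^sub>\<alpha>(b,t)\<close>, as Henstock-Kurzweil integrals,
  which extend the (proper and improper) Riemann and the Lebesgue integral. The value of the
  density at its singular endpoint does not matter.
\<close>
definition left_conf_integrable :: "real \<Rightarrow> real \<Rightarrow> real \<Rightarrow> (real \<Rightarrow> real) \<Rightarrow> bool" where
  "left_conf_integrable \<alpha> a b h \<longleftrightarrow> (\<lambda>t. h t * rpow (t - a) (\<alpha> - 1)) integrable_on {a..b}"

definition left_conf_integral :: "real \<Rightarrow> real \<Rightarrow> real \<Rightarrow> (real \<Rightarrow> real) \<Rightarrow> real" where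
  "left_conf_integral \<alpha> a b h = integral {a..b} (\<lambda>t. h t * rpow (t - a) (\<alpha> - 1))"

definition right_conf_integrable :: "real \<Rightarrow> real \<Rightarrow> real \<Rightarrow> (real \<Rightarrow> real) \<Rightarrow> bool" where
  "right_conf_integrable \<alpha> a b h \<longleftrightarrow> (\<lambda>t. h t * rpow (b - t) (\<alpha> - 1)) integrable_on {a..b}"

definition right_conf_integral :: "real \<Rightarrow> real \<Rightarrow> real \<Rightarrow> (real \<Rightarrow> real) \<Rightarrow> real" where
  "right_conf_integral \<alpha> a b h = integral {a..b} (\<lambda>t. h t * rpow (b - t) (\<alpha> - 1))"

end

theory Submission imports Defs begin

text \<open>
  At interior points the left conformable derivative of \<open>f\<close> is \<open>f' t * (t - a) powr (1 - \<alpha>)\<close>, and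
  the weight \<open>(t - a) powr (\<alpha> - 1)\<close> cancels the power; likewise on the right, with a sign. So, off the
  two endpoints, the integrands are \<open>f' * g\<close> and \<open>- f * g'\<close>, whose difference is the
  Henstock-Kurzweil integrable derivative of \<open>f * g\<close>.
\<close>

text \<open>The quotient is the difference quotient at 0 of
  \<open>\<lambda>\<epsilon>. f (t + \<epsilon> * c)\<close>, so the chain rule gives its limit.
  Taking for \<open>c\<close> the power of \<open>t - a\<close> or \<open>b - t\<close> evaluates
  both conformable derivatives.\<close>

lemma Lim_scaled_difference_quotient:
  fixes f :: "real \<Rightarrow> real"
  assumes f: "(f has_real_derivative d) (at t)" and t: "t \<in> interior D"
  shows "Lim (at 0 within {\<epsilon>. t + \<epsilon> * c \<in> D}) (\<lambda>\<epsilon>. (f (t + \<epsilon> * c) - f t) / \<epsilon>) = d * c"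
proof (rule tendsto_Lim)
  \<comment> \<open>Convergence determines \<open>Lim\<close> only along a nontrivial filter; here 0
    is interior to the set of admissible increments.\<close>
  have "open {\<epsilon>. t + \<epsilon> * c \<in> interior D}"
    using open_vimage[OF open_interior, of "\<lambda>\<epsilon>. t + \<epsilon> * c" D]
    by (simp add: vimage_def continuous_intros)
  moreover have "{\<epsilon>. t + \<epsilon> * c \<in> interior D} \<subseteq> {\<epsilon>. t + \<epsilon> * c \<in> D}"
    using interior_subset by auto
  ultimately have "0 \<in> interior {\<epsilon>. t + \<epsilon> * c \<in> D}"
    using t by (intro interiorI[of "{\<epsilon>. t + \<epsilon> * c \<in> interior D}"]) auto
  then show "at 0 within {\<epsilon>. t + \<epsilon> * c \<in> D} \<noteq> bot"
    by (metis at_within_interior trivial_limit_at)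
  have "((\<lambda>\<epsilon>. f (t + \<epsilon> * c)) has_real_derivative d * c) (at 0)"
    by (rule DERIV_chain2[of f]) (use f in \<open>auto intro!: derivative_eq_intros\<close>)
  then have "((\<lambda>\<epsilon>. (f (t + \<epsilon> * c) - f t) / \<epsilon>) \<longlongrightarrow> d * c) (at 0)"
    by (simp add: has_field_derivative_iff)
  then show "((\<lambda>\<epsilon>. (f (t + \<epsilon> * c) - f t) / \<epsilon>) \<longlongrightarrow> d * c)
      (at 0 within {\<epsilon>. t + \<epsilon> * c \<in> D})"
    by (rule tendsto_within_subset) simp
qed

lemma rpow_mult_rpow_inverse:
  assumes "x > 0"
  shows "rpow x (1 - \<alpha>) * rpow x (\<alpha> - 1) = 1"
  using assms by (simp add: rpow_def flip: powr_add)

lemma left_conf_deriv_mult_weight: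
  assumes "(f has_real_derivative d) (at t)" "t \<in> interior D" "a < t"
  shows "left_conf_deriv \<alpha> a D f t * rpow (t - a) (\<alpha> - 1) = d"
  using Lim_scaled_difference_quotient[OF assms(1,2)] rpow_mult_rpow_inverse[of "t - a" \<alpha>] assms(3)
  by (simp add: left_conf_deriv_def mult.assoc)

lemma right_conf_deriv_mult_weight:
  assumes "(g has_real_derivative d) (at t)" "t \<in> interior D" "t < b"
  shows "right_conf_deriv \<alpha> b D g t * rpow (b - t) (\<alpha> - 1) = - d"
  using Lim_scaled_difference_quotient[OF assms(1,2)] rpow_mult_rpow_inverse[of "b - t" \<alpha>] assms(3)
  by (simp add: right_conf_deriv_def mult.assoc)

text \<open>Differentiability alone does not make the integrals exist: for t^2 sin(t^-4) and t^2
  cos(t^-4) on [0,1], both 0 at 0, \<open>f' * g\<close> behaves like -(4/t) cos^2(t^-4). Hence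
  integrability is assumed on one side, and it transfers to the other.\<close>

theorem theorem3p3:
  fixes f g :: "real \<Rightarrow> real" and a b \<alpha> :: real
  assumes "a < b" and "0 < \<alpha>" and "\<alpha> \<le> 1"
    and "f differentiable_on {a..b}" and "g differentiable_on {a..b}"
    and "left_conf_integrable \<alpha> a b (\<lambda>t. left_conf_deriv \<alpha> a {a..b} f t * g t) \<or>
         right_conf_integrable \<alpha> a b (\<lambda>t. f t * right_conf_deriv \<alpha> b {a..b} g t)"
  shows "left_conf_integrable \<alpha> a b (\<lambda>t. left_conf_deriv \<alpha> a {a..b} f t * g t) \<and>
         right_conf_integrable \<alpha> a b (\<lambda>t. f t * right_conf_deriv \<alpha> b {a..b} g t) \<and>
         left_conf_integral \<alpha> a b (\<lambda>t. left_conf_deriv \<alpha> a {a..b} f t * g t) =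
           right_conf_integral \<alpha> a b (\<lambda>t. f t * right_conf_deriv \<alpha> b {a..b} g t)
           + (f b * g b - f a * g a)"
proof -
  obtain f' where f': "\<And>x. x \<in> {a..b} \<Longrightarrow> (f has_real_derivative f' x) (at x within {a..b})"
    using assms(4) unfolding differentiable_on_def real_differentiable_def by metis
  obtain g' where g': "\<And>x. x \<in> {a..b} \<Longrightarrow> (g has_real_derivative g' x) (at x within {a..b})"
    using assms(5) unfolding differentiable_on_def real_differentiable_def by metis
  define L where "L t = left_conf_deriv \<alpha> a {a..b} f t * g t * rpow (t - a) (\<alpha> - 1)" for t
  define R where "R t = f t * right_conf_deriv \<alpha> b {a..b} g t * rpow (b - t) (\<alpha> - 1)" for t
  \<comment> \<open>For the Henstock-Kurzweil integral a derivative on all of \<open>{a..b}\<close>,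
    one-sided at the endpoints, is integrable without any continuity assumption.\<close>
  have ftc: "((\<lambda>t. f' t * g t + f t * g' t) has_integral f b * g b - f a * g a) {a..b}"
    using \<open>a < b\<close>
    by (intro fundamental_theorem_of_calculus)
       (auto simp flip: has_real_derivative_iff_has_vector_derivative
             intro!: derivative_eq_intros f' g')
  \<comment> \<open>The endpoints are excluded because for \<open>\<alpha> < 1\<close> the weight
    \<open>rpow 0 (\<alpha> - 1)\<close> is 0 there, so nothing cancels. Being finitely many, they
    do not affect the integral.\<close>
  have LR: "L t - R t = f' t * g t + f t * g' t" if "t \<in> {a..b} - {a, b}" for t
  proof -
    have int: "t \<in> interior {a..b}" using that by auto
    then have "(f has_real_derivative f' t) (at t)" "(g has_real_derivative g' t) (at t)"
      using f'[of t] g'[of t] that unfolding at_within_interior[OF int] by simp_all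
    then have "left_conf_deriv \<alpha> a {a..b} f t * rpow (t - a) (\<alpha> - 1) = f' t"
      "right_conf_deriv \<alpha> b {a..b} g t * rpow (b - t) (\<alpha> - 1) = - g' t"
      using left_conf_deriv_mult_weight right_conf_deriv_mult_weight int that by auto
    moreover have "L t = (left_conf_deriv \<alpha> a {a..b} f t * rpow (t - a) (\<alpha> - 1)) * g t"
      "R t = f t * (right_conf_deriv \<alpha> b {a..b} g t * rpow (b - t) (\<alpha> - 1))"
      by (simp_all add: L_def R_def)
    ultimately show ?thesis by simp
  qed
  have diff: "((\<lambda>t. L t - R t) has_integral f b * g b - f a * g a) {a..b}"
    by (rule has_integral_spike_finite[of "{a, b}", OF _ LR ftc]) auto
  have "L integrable_on {a..b} \<or> R integrable_on {a..b}"
    using assms(6) unfolding left_conf_integrable_def right_conf_integrable_def L_def R_def .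
  \<comment> \<open>\<open>L - R\<close> is integrable outright, so either integrand is recovered
    from the other: \<open>R = L - (L - R)\<close> and \<open>L = R + (L - R)\<close>.\<close>
  then have "L integrable_on {a..b} \<and> R integrable_on {a..b}"
    using integrable_diff[of L "{a..b}" "\<lambda>t. L t - R t"]
      integrable_add[of R "{a..b}" "\<lambda>t. L t - R t"] has_integral_integrable[OF diff]
    by auto
  moreover from this have "integral {a..b} L - integral {a..b} R = f b * g b - f a * g a"
    using integral_unique[OF diff] by (simp add: integral_diff)
  ultimately show ?thesis
    unfolding left_conf_integrable_def right_conf_integrable_def left_conf_integral_def
      right_conf_integral_def L_def R_def
    by simp
qed

end
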